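(* Let $X$ be a projective variety over a number field $K$, and let $(X,\mathcal{F}=\{f_1,\dots,f_k\},\mathcal{L},\alpha)$ and $(X,\mathcal{G}=\{g_1,\dots,g_t\},\mathcal{L},\beta)$ be two polarized systems on $X$ defined over $K$, with the same $\mathcal{L}$ and with $\alpha>k$, $\beta>t$. Suppose that $f_i\circ g_j=g_j\circ f_i$ for all $i,j$. Then, for every place $v$ of $K$, the canonical metrics on $\mathcal{L}_v$ relative to $\mathcal{F}$ and $\mathcal{G}$ coincide: $$\|\cdot\|_{v,\mathcal{F}}=\|\cdot\|_{v,\mathcal{G}}.$$
   Context: Polarized system: $(X,\mathcal{F}=\{f_1,\dots,f_k\},\mathcal{L},\alpha)$ is a polarized (dynamical eigen)system on $X$ defined over $K$ if $f_1,\dots,f_k:X\to X$ are morphisms over $K$, $\mathcal{L}\in\mathrm{Pic}(X)\otimes\mathbb{R}$ is an ample line bundle, $\alpha>k$ is real, and we have an isomorphism $\phi:\mathcal{L}^{\otimes\alpha}\xrightarrow{\ \cong\ }f_1^*\mathcal{L}\otimes\cdots\otimes f_k^*\mathcal{L}$. Canonical metric: let $v$ be a place of $K$, $\mathcal{L}_v=\mathcal{L}\otimes_KK_v$, and let $\|\cdot\|_v$ be a continuous and bounded metric on the fibres of $\mathcal{L}_v$. Put $\|\cdot\|_{v,1}=\|\cdot\|_v$ and, for $n>1$, $$\|\cdot\|_{v,n}=\bigl(\phi^*(f_1^*\|\cdot\|_{v,n-1}\cdots f_k^*\|\cdot\|_{v,n-1})\bigr)^{1/\alpha}.$$ This sequence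 converges uniformly on $X(\bar K_v)$ to a metric $\|\cdot\|_{v,\mathcal{F}}$ on $\mathcal{L}_v$, independent of the choice of $\|\cdot\|_{v,1}$, which satisfies $\|\cdot\|_{v,\mathcal{F}}=\bigl(\phi^*(f_1^*\|\cdot\|_{v,\mathcal{F}}\cdots f_k^*\|\cdot\|_{v,\mathcal{F}})\bigr)^{1/\alpha}$. It is called the canonical metric on $\mathcal{L}_v$ relative to the system of maps $\mathcal{F}$. The metric $\|\cdot\|_{v,\mathcal{G}}$ is defined in the same way from $\mathcal{G}$, $\beta$ and the isomorphism $\mathcal{L}^{\otimes\beta}\cong g_1^*\mathcal{L}\otimes\cdots\otimes g_t^*\mathcal{L}$ belonging to the second system.
   Formalization: Added assumption: the two isomorphisms from the αβ-th power of L to the product of all (f_i∘g_j)^*L, built from those of the two systems in either order, agree up to torsion. Without it the claim fails (F=G, one isomorphism doubled); rescaling one isomorphism always achieves it. *)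

theory Defs
  imports "HOL-Analysis.Analysis" "HOL-Computational_Algebra.Polynomial"
begin

text \<open>
  Varieties are classical projective varieties with points in an algebraically closed
  field \<open>\<Omega>\<close> (the type \<open>'c\<close>), defined over a number field \<open>K\<close> that is a subfield of \<open>\<Omega>\<close>.
  Since the characteristic is 0, a reduced projective \<open>K\<close>-scheme, its open subsets, its regular
  functions, morphisms and line bundles over \<open>K\<close> are determined by their \<open>\<Omega>\<close>-points, so that this
  is the usual category. The one field \<open>\<Omega>\<close> serves as an algebraic closure of \<open>K\<^sub>v\<close> for all \<open>v\<close>: the
  algebraic closures of all completions of \<open>K\<close> are algebraically closed extensions of \<open>K\<close> of
  continuum transcendence degree, hence isomorphic as extensions of \<open>K\<close>, for instance to the
  complex numbers, and only the absolute value on \<open>\<Omega>\<close> depends on \<open>v\<close>.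
\<close>

section \<open>Number fields and places\<close>

definition subfield_set :: "'c::field set \<Rightarrow> bool" where
  "subfield_set K \<longleftrightarrow> 0 \<in> K \<and> 1 \<in> K \<and>
     (\<forall>x\<in>K. \<forall>y\<in>K. x + y \<in> K \<and> x * y \<in> K) \<and> (\<forall>x\<in>K. - x \<in> K \<and> inverse x \<in> K)"

definition number_field :: "'c::field_char_0 set \<Rightarrow> bool" where
  "number_field K \<longleftrightarrow> subfield_set K \<and>
     (\<exists>B. finite B \<and> B \<subseteq> K \<and> (\<forall>x\<in>K. \<exists>q :: 'c \<Rightarrow> rat. x = (\<Sum>b\<in>B. of_rat (q b) * b)))"

definition absolute_value_on :: "'c::field set \<Rightarrow> ('c \<Rightarrow> real) \<Rightarrow> bool" where
  "absolute_value_on A w \<longleftrightarrow>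
     (\<forall>x\<in>A. w x \<ge> 0 \<and> (w x = 0 \<longleftrightarrow> x = 0)) \<and>
     (\<forall>x\<in>A. \<forall>y\<in>A. w (x * y) = w x * w y \<and> w (x + y) \<le> w x + w y)"

text \<open>A place is given by a nontrivial absolute value representing it.\<close>

definition place :: "'c::field set \<Rightarrow> ('c \<Rightarrow> real) \<Rightarrow> bool" where
  "place K v \<longleftrightarrow> absolute_value_on K v \<and> (\<exists>x\<in>K. x \<noteq> 0 \<and> v x \<noteq> 1)"

text \<open>\<open>(\<Omega>, w)\<close> is an algebraic closure of the completion \<open>K\<^sub>v\<close>, with the absolute value
  extending \<open>v\<close>; \<open>\<Omega>\<close> is algebraically closed by its sort.\<close>

definition closure_of_completion ::
    "'c::{alg_closed_field,field_char_0} set \<Rightarrow> ('c \<Rightarrow> real) \<Rightarrow> ('c \<Rightarrow> real) \<Rightarrow> bool" where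
  "closure_of_completion K v w \<longleftrightarrow>
     absolute_value_on UNIV w \<and> (\<forall>x\<in>K. w x = v x) \<and>
     (\<exists>Kv. subfield_set Kv \<and> K \<subseteq> Kv \<and>
        Metric_space.mcomplete Kv (\<lambda>x y. w (x - y)) \<and>
        (\<forall>x\<in>Kv. \<forall>\<epsilon>>0. \<exists>y\<in>K. w (x - y) < \<epsilon>) \<and>
        (\<forall>x. \<exists>P :: 'c poly. P \<noteq> 0 \<and> (\<forall>i. coeff P i \<in> Kv) \<and> poly P x = 0))"

section \<open>Projective varieties over \<open>K\<close>\<close>

text \<open>A point of projective \<open>n\<close>-space is the set of all its vectors of homogeneous coordinates,
  indexed by \<open>0, \<dots>, n\<close> and continued by 0.\<close>

type_synonym 'c point = "(nat \<Rightarrow> 'c) set"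

definition mk_point :: "(nat \<Rightarrow> 'c::field) \<Rightarrow> 'c point" where
  "mk_point x = {(\<lambda>i. t * x i) | t. t \<noteq> 0}"

definition proj_space :: "nat \<Rightarrow> 'c::field point set" where
  "proj_space n = {mk_point x | x. (\<forall>i>n. x i = 0) \<and> (\<exists>i\<le>n. x i \<noteq> 0)}"

definition exponents :: "nat \<Rightarrow> nat \<Rightarrow> (nat \<Rightarrow> nat) set" where
  "exponents n d = {e. (\<forall>i>n. e i = 0) \<and> (\<Sum>i\<le>n. e i) = d}"

text \<open>Forms of degree \<open>d\<close> over \<open>K\<close> in \<open>n + 1\<close> variables, as functions (\<open>\<Omega>\<close> is infinite).\<close>

definition forms :: "'c::field set \<Rightarrow> nat \<Rightarrow> nat \<Rightarrow> ((nat \<Rightarrow> 'c) \<Rightarrow> 'c) set" where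
  "forms K n d = {F. \<exists>a. (\<forall>e\<in>exponents n d. a e \<in> K) \<and>
     F = (\<lambda>x. \<Sum>e\<in>exponents n d. a e * (\<Prod>i\<le>n. x i ^ e i))}"

definition zclosed :: "'c::field set \<Rightarrow> nat \<Rightarrow> 'c point set \<Rightarrow> bool" where
  "zclosed K n Z \<longleftrightarrow> (\<exists>S. S \<subseteq> (\<Union>d. forms K n d) \<and>
     Z = {p \<in> proj_space n. \<forall>F\<in>S. \<forall>x\<in>p. F x = 0})"

definition zopen :: "'c::field set \<Rightarrow> nat \<Rightarrow> 'c point set \<Rightarrow> 'c point set \<Rightarrow> bool" where
  "zopen K n X U \<longleftrightarrow> (\<exists>Z. zclosed K n Z \<and> U = X - Z)"

definition projective_variety :: "'c::field set \<Rightarrow> nat \<Rightarrow> 'c point set \<Rightarrow> bool" where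
  "projective_variety K n X \<longleftrightarrow> zclosed K n X \<and> X \<noteq> {} \<and>
     (\<forall>Z1 Z2. zclosed K n Z1 \<and> zclosed K n Z2 \<and> X \<subseteq> Z1 \<union> Z2 \<longrightarrow> X \<subseteq> Z1 \<or> X \<subseteq> Z2)"

definition regular :: "'c::field set \<Rightarrow> nat \<Rightarrow> 'c point set \<Rightarrow> ('c point \<Rightarrow> 'c) \<Rightarrow> bool" where
  "regular K n U u \<longleftrightarrow> (\<forall>p\<in>U. \<exists>d. \<exists>F\<in>forms K n d. \<exists>G\<in>forms K n d.
     (\<forall>x\<in>p. G x \<noteq> 0) \<and> (\<forall>q\<in>U. \<forall>x\<in>q. G x \<noteq> 0 \<longrightarrow> u q = F x / G x))"

definition morphism :: "'c::field set \<Rightarrow> nat \<Rightarrow> 'c point set \<Rightarrow> nat \<Rightarrow> 'c point set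
    \<Rightarrow> ('c point \<Rightarrow> 'c point) \<Rightarrow> bool" where
  "morphism K n X N Y f \<longleftrightarrow> f ` X \<subseteq> Y \<and>
     (\<forall>p\<in>X. \<exists>d F. (\<forall>j\<le>N. F j \<in> forms K n d) \<and> (\<exists>j\<le>N. \<forall>x\<in>p. F j x \<noteq> 0) \<and>
        (\<forall>q\<in>X. \<forall>x\<in>q. (\<exists>j\<le>N. F j x \<noteq> 0) \<longrightarrow>
           f q = mk_point (\<lambda>j. if j \<le> N then F j x else 0)))"

section \<open>Line bundles\<close>

text \<open>
  A line bundle is a family of one-dimensional vector spaces (its fibres) with an atlas of local
  frames. Each fibre is identified, as a mere vector space, with \<open>\<Omega>\<close>; the geometry is
  in the atlas, a set of pairs \<open>(U, e)\<close> of an open set and a frame \<open>e\<close> over \<open>U\<close> whose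
  transition functions are regular. No regularity is asked of the frames themselves. A
  cocycle \<open>g\<^sub>i\<^sub>j\<close> on a cover \<open>U\<^sub>i\<close> is realised by choosing an index \<open>\<iota> p\<close> with \<open>p \<in> U\<^bsub>\<iota> p\<^esub>\<close>
  for each \<open>p\<close> and taking the frames \<open>e\<^sub>i p = g\<^bsub>i (\<iota> p)\<^esub> p\<close>, so that \<open>e\<^sub>i / e\<^sub>j = g\<^sub>i\<^sub>j\<close>.
\<close>

type_synonym 'c lbundle = "('c point set \<times> ('c point \<Rightarrow> 'c)) set"

definition line_bundle :: "'c::field set \<Rightarrow> nat \<Rightarrow> 'c point set \<Rightarrow> 'c lbundle \<Rightarrow> bool" where
  "line_bundle K n X L \<longleftrightarrow>
     (\<forall>(U, e)\<in>L. zopen K n X U \<and> (\<forall>p\<in>U. e p \<noteq> 0)) \<and>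
     (\<forall>(U, e)\<in>L. \<forall>(U', e')\<in>L. regular K n (U \<inter> U') (\<lambda>p. e p / e' p)) \<and>
     (\<Union>(U, e)\<in>L. U) = X"

definition frame :: "'c::field set \<Rightarrow> nat \<Rightarrow> 'c point set \<Rightarrow> 'c lbundle \<Rightarrow> 'c point set
    \<Rightarrow> ('c point \<Rightarrow> 'c) \<Rightarrow> bool" where
  "frame K n X L U e \<longleftrightarrow> zopen K n X U \<and> (\<forall>p\<in>U. e p \<noteq> 0) \<and>
     (\<forall>(U', e')\<in>L. regular K n (U \<inter> U') (\<lambda>p. e p / e' p))"

definition lb_trivial :: "'c::field point set \<Rightarrow> 'c lbundle" where
  "lb_trivial X = {(X, \<lambda>_. 1)}"

definition lb_tensor :: "'c::field lbundle \<Rightarrow> 'c lbundle \<Rightarrow> 'c lbundle" where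
  "lb_tensor L M = {(U \<inter> U', \<lambda>p. e p * e' p) | U e U' e'. (U, e) \<in> L \<and> (U', e') \<in> M}"

definition lb_power :: "'c::field lbundle \<Rightarrow> int \<Rightarrow> 'c lbundle" where
  "lb_power L k = {(U, \<lambda>p. e p powi k) | U e. (U, e) \<in> L}"

definition lb_pullback ::
    "'c::field point set \<Rightarrow> ('c point \<Rightarrow> 'c point) \<Rightarrow> 'c lbundle \<Rightarrow> 'c lbundle" where
  "lb_pullback X f L = {(X \<inter> f -` U, \<lambda>p. e (f p)) | U e. (U, e) \<in> L}"

definition lb_monomial :: "'c::field point set \<Rightarrow> 'c lbundle list \<Rightarrow> int list \<Rightarrow> 'c lbundle" where
  "lb_monomial X Ls ks =
     foldr (\<lambda>(L, k). lb_tensor (lb_power L k)) (zip Ls ks) (lb_trivial X)"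

text \<open>An isomorphism of line bundles is multiplication by \<open>h p\<close> on the fibres over \<open>p\<close>.\<close>

definition lb_iso :: "'c::field set \<Rightarrow> nat \<Rightarrow> 'c point set \<Rightarrow> 'c lbundle \<Rightarrow> 'c lbundle
    \<Rightarrow> ('c point \<Rightarrow> 'c) \<Rightarrow> bool" where
  "lb_iso K n X L M h \<longleftrightarrow> (\<forall>p\<in>X. h p \<noteq> 0) \<and>
     (\<forall>(U, e)\<in>L. \<forall>(U', e')\<in>M. regular K n (U \<inter> U') (\<lambda>p. h p * e p / e' p))"

text \<open>\<open>O(1)\<close> on projective \<open>N\<close>-space: the fibre at a point is the dual of the corresponding line,
  identified with \<open>\<Omega>\<close> by evaluation at a chosen vector; the frames are the coordinates.\<close>

definition lb_O1 :: "nat \<Rightarrow> 'c::field lbundle" where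
  "lb_O1 N = {({p \<in> proj_space N. \<forall>x\<in>p. x i \<noteq> 0}, \<lambda>p. (SOME x. x \<in> p) i) | i. i \<le> N}"

text \<open>\<open>L\<close> is ample if some positive power is the restriction of \<open>O(1)\<close> along a closed
  immersion \<open>g\<close>, that is an isomorphism onto a closed subvariety \<open>Y\<close>.\<close>

definition ample :: "'c::field set \<Rightarrow> nat \<Rightarrow> 'c point set \<Rightarrow> 'c lbundle \<Rightarrow> bool" where
  "ample K n X L \<longleftrightarrow> (\<exists>k::nat>0. \<exists>N Y g g' h.
     zclosed K N Y \<and> morphism K n X N Y g \<and> morphism K N Y n X g' \<and>
     (\<forall>p\<in>X. g' (g p) = p) \<and> (\<forall>q\<in>Y. g (g' q) = q) \<and>
     lb_iso K n X (lb_power L (int k)) (lb_pullback X g (lb_O1 N)) h)"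

section \<open>Elements of \<open>Pic(X) \<otimes> \<real>\<close>\<close>

text \<open>The list \<open>[(r\<^sub>1, L\<^sub>1), \<dots>]\<close> stands for the tensor product of the real powers \<open>L\<^sub>a\<^bsup>r\<^sub>a\<^esup>\<close>.\<close>

type_synonym 'c rlbundle = "(real \<times> 'c lbundle) list"

definition rl_bundle :: "'c::field set \<Rightarrow> nat \<Rightarrow> 'c point set \<Rightarrow> 'c rlbundle \<Rightarrow> bool" where
  "rl_bundle K n X \<L> \<longleftrightarrow> (\<forall>(r, L)\<in>set \<L>. line_bundle K n X L)"

definition rl_power :: "real \<Rightarrow> 'c rlbundle \<Rightarrow> 'c rlbundle" where
  "rl_power \<alpha> \<L> = map (\<lambda>(r, L). (\<alpha> * r, L)) \<L>"

definition rl_pullback ::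
    "'c::field point set \<Rightarrow> ('c point \<Rightarrow> 'c point) \<Rightarrow> 'c rlbundle \<Rightarrow> 'c rlbundle" where
  "rl_pullback X f \<L> = map (\<lambda>(r, L). (r, lb_pullback X f L)) \<L>"

text \<open>\<open>f\<^sub>1\<^sup>*\<L> \<otimes> \<dots> \<otimes> f\<^sub>k\<^sup>*\<L>\<close>\<close>

definition rl_pullbacks ::
    "'c::field point set \<Rightarrow> ('c point \<Rightarrow> 'c point) list \<Rightarrow> 'c rlbundle \<Rightarrow> 'c rlbundle" where
  "rl_pullbacks X fs \<L> = concat (map (\<lambda>f. rl_pullback X f \<L>) fs)"

text \<open>
  An isomorphism in \<open>Pic(X) \<otimes> \<real>\<close> is a real combination of isomorphisms of line bundles:
  a list of \<open>(c, ks, ls, h)\<close>, where \<open>h\<close> is an isomorphism from the product of the \<open>L\<^sub>a\<^bsup>ks\<^sub>a\<^esup>\<close> to the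
  product of the \<open>M\<^sub>b\<^bsup>ls\<^sub>b\<^esup>\<close> taken to the power \<open>c\<close>, such that the exponents add up to those of
  source and target. By flatness of \<open>\<real>\<close>, one exists if and only if the classes of source and target
  in \<open>Pic(X) \<otimes> \<real>\<close> are equal.
\<close>

type_synonym 'c riso = "(real \<times> int list \<times> int list \<times> ('c point \<Rightarrow> 'c)) list"

definition rl_iso :: "'c::field set \<Rightarrow> nat \<Rightarrow> 'c point set \<Rightarrow> 'c rlbundle \<Rightarrow> 'c rlbundle
    \<Rightarrow> 'c riso \<Rightarrow> bool" where
  "rl_iso K n X \<L> \<M> \<phi> \<longleftrightarrow>
     (\<forall>(c, ks, ls, h)\<in>set \<phi>. length ks = length \<L> \<and> length ls = length \<M> \<and>
        lb_iso K n X (lb_monomial X (map snd \<L>) ks) (lb_monomial X (map snd \<M>) ls) h) \<and>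
     (\<forall>a<length \<L>. (\<Sum>(c, ks, ls, h)\<leftarrow>\<phi>. c * of_int (ks ! a)) = fst (\<L> ! a)) \<and>
     (\<forall>b<length \<M>. (\<Sum>(c, ks, ls, h)\<leftarrow>\<phi>. c * of_int (ls ! b)) = fst (\<M> ! b))"

definition rl_ample :: "'c::field set \<Rightarrow> nat \<Rightarrow> 'c point set \<Rightarrow> 'c rlbundle \<Rightarrow> bool" where
  "rl_ample K n X \<L> \<longleftrightarrow> (\<exists>\<A> \<phi>. \<A> \<noteq> [] \<and>
     (\<forall>(r, A)\<in>set \<A>. r > 0 \<and> line_bundle K n X A \<and> ample K n X A) \<and> rl_iso K n X \<L> \<A> \<phi>)"

section \<open>Polarized systems\<close>

definition polarized_system :: "'c::field set \<Rightarrow> nat \<Rightarrow> 'c point set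
    \<Rightarrow> ('c point \<Rightarrow> 'c point) list \<Rightarrow> 'c rlbundle \<Rightarrow> real \<Rightarrow> 'c riso \<Rightarrow> bool" where
  "polarized_system K n X fs \<L> \<alpha> \<phi> \<longleftrightarrow>
     fs \<noteq> [] \<and> (\<forall>f\<in>set fs. morphism K n X n X f) \<and>
     rl_bundle K n X \<L> \<and> rl_ample K n X \<L> \<and> \<alpha> > real (length fs) \<and>
     rl_iso K n X (rl_power \<alpha> \<L>) (rl_pullbacks X fs \<L>) \<phi>"

text \<open>
  In the identifications of the fibres with \<open>\<Omega>\<close>, an isomorphism \<open>\<phi>\<close> is at \<open>p\<close>
  the element \<open>\<Sum> h p \<otimes> c\<close> of \<open>\<Omega>\<^sup>* \<otimes> \<real>\<close>. Elements of this real vector space are separated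
  by the homomorphisms \<open>\<eta>\<close> from \<open>\<Omega>\<^sup>*\<close> to the additive group \<open>\<real>\<close>, extended linearly.
\<close>

definition multiplicative_char :: "('c::field \<Rightarrow> real) \<Rightarrow> bool" where
  "multiplicative_char \<eta> \<longleftrightarrow> (\<forall>x y. x \<noteq> 0 \<and> y \<noteq> 0 \<longrightarrow> \<eta> (x * y) = \<eta> x + \<eta> y)"

definition riso_value :: "('c \<Rightarrow> real) \<Rightarrow> 'c riso \<Rightarrow> 'c point \<Rightarrow> real" where
  "riso_value \<eta> \<phi> p = (\<Sum>(c, ks, ls, h)\<leftarrow>\<phi>. c * \<eta> (h p))"

text \<open>
  For commuting systems, \<open>\<phi>\<close> and \<open>\<psi>\<close> give two isomorphisms from \<open>\<L>\<^bsup>\<alpha>\<beta>\<^esup>\<close> to the product of all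
  \<open>(g\<^sub>j \<circ> f\<^sub>i)\<^sup>*\<L> = (f\<^sub>i \<circ> g\<^sub>j)\<^sup>*\<L>\<close>: \<open>\<phi>\<^bsup>\<beta>\<^esup>\<close> followed by the product of the \<open>f\<^sub>i\<^sup>*\<psi>\<close>, and \<open>\<psi>\<^bsup>\<alpha>\<^esup>\<close>
  followed by the product of the \<open>g\<^sub>j\<^sup>*\<phi>\<close>. They are required to be equal. The canonical metrics
  depend on \<open>\<phi>\<close> and \<open>\<psi>\<close>, not only on the maps: replacing \<open>\<phi>\<close> by \<open>a \<phi>\<close> for a constant \<open>a\<close>
  multiplies the metric by a power of \<open>\<bar>a\<bar>\<^sub>v\<close>.
\<close>

definition compatible_isos :: "'c::field point set
    \<Rightarrow> ('c point \<Rightarrow> 'c point) list \<Rightarrow> real \<Rightarrow> 'c riso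
    \<Rightarrow> ('c point \<Rightarrow> 'c point) list \<Rightarrow> real \<Rightarrow> 'c riso \<Rightarrow> bool" where
  "compatible_isos X fs \<alpha> \<phi> gs \<beta> \<psi> \<longleftrightarrow>
     (\<forall>\<eta>. multiplicative_char \<eta> \<longrightarrow> (\<forall>p\<in>X.
        \<beta> * riso_value \<eta> \<phi> p + (\<Sum>f\<leftarrow>fs. riso_value \<eta> \<psi> (f p)) =
        \<alpha> * riso_value \<eta> \<psi> p + (\<Sum>g\<leftarrow>gs. riso_value \<eta> \<phi> (g p))))"

section \<open>Metrics\<close>

text \<open>
  A nonzero vector of the fibre of \<open>\<L>\<close> at a point is a formal product of real powers \<open>s\<^sub>a\<^bsup>r\<^sub>a\<^esup>\<close> of
  nonzero vectors of the fibres of the \<open>L\<^sub>a\<close>. A metric sends a point \<open>p\<close> and the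
  list of the \<open>s\<^sub>a\<close> to the norm of this product. For \<open>\<L> = [(1, L)]\<close> it is a norm on the
  fibres of \<open>L\<close>.
\<close>

type_synonym 'c metric = "'c point \<Rightarrow> 'c list \<Rightarrow> real"

definition fibre :: "'c::field rlbundle \<Rightarrow> 'c list set" where
  "fibre \<L> = {s. length s = length \<L> \<and> 0 \<notin> set s}"

definition metric_on :: "('c::field \<Rightarrow> real) \<Rightarrow> 'c point set \<Rightarrow> 'c rlbundle \<Rightarrow> 'c metric \<Rightarrow> bool"
  where
  "metric_on w X \<L> m \<longleftrightarrow> (\<forall>p\<in>X. \<forall>s\<in>fibre \<L>. m p s > 0 \<and>
     (\<forall>a<length \<L>. \<forall>t. t \<noteq> 0 \<longrightarrow> m p (s[a := t * s ! a]) = w t powr fst (\<L> ! a) * m p s))"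

text \<open>Continuity for the topology on projective space induced by \<open>w\<close>, the quotient of the one
  on nonzero coordinate vectors.\<close>

definition w_continuous_on ::
    "('c::field \<Rightarrow> real) \<Rightarrow> nat \<Rightarrow> 'c point set \<Rightarrow> ('c point \<Rightarrow> real) \<Rightarrow> bool" where
  "w_continuous_on w n U u \<longleftrightarrow> (\<forall>p\<in>U. \<forall>x\<in>p. \<forall>\<epsilon>>0. \<exists>\<delta>>0. \<forall>q\<in>U. \<forall>y\<in>q.
     (\<forall>i\<le>n. w (y i - x i) < \<delta>) \<longrightarrow> \<bar>u q - u p\<bar> < \<epsilon>)"

definition frames :: "'c::field set \<Rightarrow> nat \<Rightarrow> 'c point set \<Rightarrow> 'c rlbundle \<Rightarrow> 'c point set
    \<Rightarrow> ('c point \<Rightarrow> 'c) list \<Rightarrow> bool" where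
  "frames K n X \<L> U es \<longleftrightarrow> list_all2 (\<lambda>(r, L) e. frame K n X L U e) \<L> es"

definition continuous_metric :: "'c::field set \<Rightarrow> ('c \<Rightarrow> real) \<Rightarrow> nat \<Rightarrow> 'c point set
    \<Rightarrow> 'c rlbundle \<Rightarrow> 'c metric \<Rightarrow> bool" where
  "continuous_metric K w n X \<L> m \<longleftrightarrow> (\<forall>U es. zopen K n X U \<and> frames K n X \<L> U es \<longrightarrow>
     w_continuous_on w n U (\<lambda>p. m p (map (\<lambda>e. e p) es)))"

text \<open>A metric is bounded if the logarithm of the norm of a frame over an affine open set is
  bounded on bounded subsets. Affine open sets are restricted to the complements of hypersurfaces,
  which form a basis; a subset of an affine set is bounded if all regular functions are bounded on
  it. On a projective variety, any two bounded metrics have a bounded ratio.\<close>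

definition principal_open ::
    "'c::field set \<Rightarrow> nat \<Rightarrow> 'c point set \<Rightarrow> 'c point set \<Rightarrow> bool" where
  "principal_open K n X U \<longleftrightarrow> (\<exists>d>0. \<exists>G\<in>forms K n d. U = {p \<in> X. \<forall>x\<in>p. G x \<noteq> 0})"

definition bounded_in :: "'c::field set \<Rightarrow> ('c \<Rightarrow> real) \<Rightarrow> nat \<Rightarrow> 'c point set
    \<Rightarrow> 'c point set \<Rightarrow> bool" where
  "bounded_in K w n U E \<longleftrightarrow> E \<subseteq> U \<and>
     (\<forall>u. regular K n U u \<longrightarrow> (\<exists>B. \<forall>p\<in>E. w (u p) \<le> B))"

definition bounded_metric :: "'c::field set \<Rightarrow> ('c \<Rightarrow> real) \<Rightarrow> nat \<Rightarrow> 'c point set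
    \<Rightarrow> 'c rlbundle \<Rightarrow> 'c metric \<Rightarrow> bool" where
  "bounded_metric K w n X \<L> m \<longleftrightarrow>
     (\<forall>U E es. principal_open K n X U \<and> bounded_in K w n U E \<and> frames K n X \<L> U es \<longrightarrow>
        (\<exists>B. \<forall>p\<in>E. \<bar>ln (m p (map (\<lambda>e. e p) es))\<bar> \<le> B))"

definition admissible_metric :: "'c::field set \<Rightarrow> ('c \<Rightarrow> real) \<Rightarrow> nat \<Rightarrow> 'c point set
    \<Rightarrow> 'c rlbundle \<Rightarrow> 'c metric \<Rightarrow> bool" where
  "admissible_metric K w n X \<L> m \<longleftrightarrow>
     metric_on w X \<L> m \<and> continuous_metric K w n X \<L> m \<and> bounded_metric K w n X \<L> m"

section \<open>The canonical metric\<close>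

definition pullback_metric :: "('c point \<Rightarrow> 'c point) \<Rightarrow> 'c metric \<Rightarrow> 'c metric" where
  "pullback_metric f m = (\<lambda>p s. m (f p) s)"

text \<open>Tensor product of metrics on \<open>\<R>\<close>-line bundles given by lists of the same length \<open>l\<close>.\<close>

fun tensor_metrics :: "nat \<Rightarrow> 'c metric list \<Rightarrow> 'c metric" where
  "tensor_metrics l [] = (\<lambda>p s. 1)"
| "tensor_metrics l (m # ms) = (\<lambda>p s. m p (take l s) * tensor_metrics l ms p (drop l s))"

definition vec_monomial :: "'c::field list \<Rightarrow> int list \<Rightarrow> 'c" where
  "vec_monomial s ks = (\<Prod>(x, k)\<leftarrow>zip s ks. x powi k)"

text \<open>The metric \<open>\<phi>\<^sup>*m\<close> for a metric \<open>m\<close> on a target of length \<open>l\<close>: the component \<open>(c, ks, ls, h)\<close>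
  of \<open>\<phi>\<close> maps the monomial of \<open>s\<close> to its product with \<open>h p\<close>, as a multiple of the
  vector that is 1 in every factor of the target.\<close>

definition iso_pullback_metric ::
    "('c::field \<Rightarrow> real) \<Rightarrow> nat \<Rightarrow> 'c riso \<Rightarrow> 'c metric \<Rightarrow> 'c metric" where
  "iso_pullback_metric w l \<phi> m = (\<lambda>p s.
     (\<Prod>(c, ks, ls, h)\<leftarrow>\<phi>. w (h p * vec_monomial s ks) powr c) * m p (replicate l 1))"

definition metric_step :: "('c::field \<Rightarrow> real) \<Rightarrow> ('c point \<Rightarrow> 'c point) list \<Rightarrow> 'c rlbundle
    \<Rightarrow> real \<Rightarrow> 'c riso \<Rightarrow> 'c metric \<Rightarrow> 'c metric" where
  "metric_step w fs \<L> \<alpha> \<phi> m = (\<lambda>p s.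
     iso_pullback_metric w (length fs * length \<L>) \<phi>
       (tensor_metrics (length \<L>) (map (\<lambda>f. pullback_metric f m) fs)) p s powr (1 / \<alpha>))"

definition metric_converges :: "'c::field point set \<Rightarrow> 'c rlbundle \<Rightarrow> (nat \<Rightarrow> 'c metric)
    \<Rightarrow> 'c metric \<Rightarrow> bool" where
  "metric_converges X \<L> ms m \<longleftrightarrow> (\<forall>\<epsilon>>0. \<exists>N. \<forall>k\<ge>N. \<forall>p\<in>X. \<forall>s\<in>fibre \<L>.
     \<bar>ln (ms k p s / m p s)\<bar> < \<epsilon>)"

text \<open>The canonical metric is the uniform limit of the sequence started at any continuous
  and bounded metric, independently of this choice.\<close>

definition canonical_metric :: "'c::field set \<Rightarrow> ('c \<Rightarrow> real) \<Rightarrow> nat \<Rightarrow> 'c point set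
    \<Rightarrow> ('c point \<Rightarrow> 'c point) list \<Rightarrow> 'c rlbundle \<Rightarrow> real \<Rightarrow> 'c riso \<Rightarrow> 'c metric \<Rightarrow> bool" where
  "canonical_metric K w n X fs \<L> \<alpha> \<phi> m \<longleftrightarrow> admissible_metric K w n X \<L> m \<and>
     (\<forall>m1. admissible_metric K w n X \<L> m1 \<longrightarrow>
        metric_converges X \<L> (\<lambda>k. (metric_step w fs \<L> \<alpha> \<phi> ^^ k) m1) m)"

end

theory Submission
  imports Defs
begin

text \<open>
  In logarithms, and on the vectors that are 1 in every factor, the two metric steps become affine
  operators \<open>S\<close>, \<open>T\<close> on real functions on \<open>X\<close>. They are continuous for pointwise convergence, and
  by compatibility of the isomorphisms they commute. Let \<open>u\<^sub>F\<close>, \<open>u\<^sub>G\<close> be the canonical metrics.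
  As a limit of its own iterates, \<open>u\<^sub>G\<close> is fixed by \<open>T\<close>; hence so is \<open>S\<^sup>k u\<^sub>G\<close> for all \<open>k\<close>, and in
  the limit \<open>u\<^sub>F\<close>. The iterates of \<open>T\<close> on \<open>u\<^sub>F\<close> are thus constant, and they converge to \<open>u\<^sub>G\<close>.
\<close>

section \<open>Affine operators on real functions and the limits of two commuting ones\<close>

definition log_norm :: "nat \<Rightarrow> 'c::field metric \<Rightarrow> 'c point \<Rightarrow> real" where
  "log_norm l m p = ln (m p (replicate l 1))"

text \<open>In the application \<open>V\<close> is \<open>riso_value\<close> of the isomorphism at
  the character \<open>ln (w x)\<close>, and the operator is the logarithm of
  \<open>metric_step\<close> on vectors of ones.\<close>

definition log_step :: "('a \<Rightarrow> 'a) list \<Rightarrow> real \<Rightarrow> ('a \<Rightarrow> real) \<Rightarrow> ('a \<Rightarrow> real) \<Rightarrow> 'a \<Rightarrow> real" where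
  "log_step fs \<alpha> V u p = (V p + (\<Sum>f\<leftarrow>fs. u (f p))) / \<alpha>"

lemma log_step_cong:
  assumes "\<And>f. f \<in> set fs \<Longrightarrow> u (f p) = u' (f p)"
  shows "log_step fs \<alpha> V u p = log_step fs \<alpha> V u' p"
proof -
  have "(\<Sum>f\<leftarrow>fs. u (f p)) = (\<Sum>f\<leftarrow>fs. u' (f p))"
    using assms by (induction fs) auto
  then show ?thesis by (simp add: log_step_def)
qed

lemma log_step_tendsto:
  assumes "\<And>f. f \<in> set fs \<Longrightarrow> (\<lambda>k. U k (f p)) \<longlonglongrightarrow> u (f p)"
  shows "(\<lambda>k. log_step fs \<alpha> V (U k) p) \<longlonglongrightarrow> log_step fs \<alpha> V u p"
proof -
  have "(\<lambda>k. \<Sum>f\<leftarrow>fs. U k (f p)) \<longlonglongrightarrow> (\<Sum>f\<leftarrow>fs. u (f p))"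
    using assms by (induction fs) (auto intro!: tendsto_add)
  then show ?thesis
    unfolding log_step_def divide_inverse by (intro tendsto_intros)
qed

text \<open>Both composites have denominator \<open>\<alpha> * \<beta>\<close>. In the numerators
  the double sums of \<open>u\<close> agree because the maps commute at \<open>p\<close>, and the
  remaining terms are the two sides of the last assumption, which is \<open>compatible_isos\<close>
  at one character.\<close>

lemma log_step_commute:
  assumes "\<alpha> \<noteq> 0" "\<beta> \<noteq> 0"
    and "\<And>f g. f \<in> set fs \<Longrightarrow> g \<in> set gs \<Longrightarrow> f (g p) = g (f p)"
    and "\<beta> * V p + (\<Sum>f\<leftarrow>fs. W (f p)) = \<alpha> * W p + (\<Sum>g\<leftarrow>gs. V (g p))"
  shows "log_step fs \<alpha> V (log_step gs \<beta> W u) p = log_step gs \<beta> W (log_step fs \<alpha> V u) p"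
proof -
  \<comment> \<open>Stated for arbitrary lists and constants, so that it rewrites both orders of
    composition.\<close>
  have expand: "log_step as a A (log_step bs b B u) p =
      (b * A p + (\<Sum>f\<leftarrow>as. B (f p)) + (\<Sum>f\<leftarrow>as. \<Sum>g\<leftarrow>bs. u (g (f p)))) / (a * b)"
    if "a \<noteq> 0" "b \<noteq> 0" for as bs :: "('a \<Rightarrow> 'a) list" and a b A B
  proof -
    have "(\<Sum>f\<leftarrow>as. (B (f p) + (\<Sum>g\<leftarrow>bs. u (g (f p)))) / b) =
        ((\<Sum>f\<leftarrow>as. B (f p)) + (\<Sum>f\<leftarrow>as. \<Sum>g\<leftarrow>bs. u (g (f p)))) / b"
      by (induction as) (auto simp: add_divide_distrib)
    then show ?thesis
      using that by (simp add: log_step_def field_simps)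
  qed
  have "(\<Sum>f\<leftarrow>fs. \<Sum>g\<leftarrow>gs. u (g (f p))) = (\<Sum>g\<leftarrow>gs. \<Sum>f\<leftarrow>fs. u (f (g p)))"
    using assms(3)
  proof (induction fs)
    case (Cons f fs)
    have "(\<Sum>g\<leftarrow>gs. u (g (f p))) = (\<Sum>g\<leftarrow>gs. u (f (g p)))"
      using Cons.prems by (intro arg_cong[where f = sum_list] map_cong) auto
    moreover have "(\<Sum>f\<leftarrow>fs. \<Sum>g\<leftarrow>gs. u (g (f p))) = (\<Sum>g\<leftarrow>gs. \<Sum>f\<leftarrow>fs. u (f (g p)))"
      using Cons.prems by (intro Cons.IH) auto
    ultimately show ?case by (simp add: sum_list_addf)
  qed simp
  then show ?thesis
    using assms by (simp add: expand mult.commute)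
qed

text \<open>By continuity the sequence in \<open>shift\<close> also tends to
  \<open>log_step fs \<alpha> V u p\<close>. \<open>U\<close> stays general: it will be once the
  iterates of the operator itself and once those of the operator commuting with it.\<close>

lemma log_step_limit_fixed:
  assumes maps: "\<And>f. f \<in> set fs \<Longrightarrow> f ` X \<subseteq> X"
    and lim: "\<And>p. p \<in> X \<Longrightarrow> (\<lambda>k. U k p) \<longlonglongrightarrow> u p"
    and shift: "\<And>p. p \<in> X \<Longrightarrow> (\<lambda>k. log_step fs \<alpha> V (U k) p) \<longlonglongrightarrow> u p"
    and p: "p \<in> X"
  shows "log_step fs \<alpha> V u p = u p"
proof -
  have "(\<lambda>k. log_step fs \<alpha> V (U k) p) \<longlonglongrightarrow> log_step fs \<alpha> V u p"
    using lim maps p by (intro log_step_tendsto) blast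
  then show ?thesis
    using shift[OF p] by (rule LIMSEQ_unique)
qed

text \<open>\<open>S\<close> is started at \<open>v\<close>, the limit for \<open>T\<close>. In
  \<open>lim_T\<close> the start \<open>v\<close> makes \<open>v\<close> a fixed point of
  \<open>T\<close>, and the start \<open>u\<close> identifies the two limits.\<close>

lemma commuting_log_steps_same_limit:
  fixes X :: "'a set" and fs gs \<alpha> \<beta> V W
  defines "S \<equiv> log_step fs \<alpha> V" and "T \<equiv> log_step gs \<beta> W"
  assumes fmaps: "\<And>f. f \<in> set fs \<Longrightarrow> f ` X \<subseteq> X"
    and gmaps: "\<And>g. g \<in> set gs \<Longrightarrow> g ` X \<subseteq> X"
    and commute: "\<And>u p. p \<in> X \<Longrightarrow> S (T u) p = T (S u) p"
    and lim_S: "\<And>p. p \<in> X \<Longrightarrow> (\<lambda>k. (S ^^ k) v p) \<longlonglongrightarrow> u p"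
    and lim_T: "\<And>u' p. u' \<in> {u, v} \<Longrightarrow> p \<in> X \<Longrightarrow> (\<lambda>k. (T ^^ k) u' p) \<longlonglongrightarrow> v p"
    and p: "p \<in> X"
  shows "u p = v p"
proof -
  \<comment> \<open>Functions are compared on \<open>X\<close> alone; such equalities pass through
    \<open>S\<close> and \<open>T\<close> because the maps preserve \<open>X\<close>.\<close>
  have S_cong: "S a q = S b q" if "\<And>q. q \<in> X \<Longrightarrow> a q = b q" "q \<in> X" for a b q
    unfolding S_def using that fmaps by (intro log_step_cong) blast
  have T_cong: "T a q = T b q" if "\<And>q. q \<in> X \<Longrightarrow> a q = b q" "q \<in> X" for a b q
    unfolding T_def using that gmaps by (intro log_step_cong) blast
  have Tv: "T v q = v q" if "q \<in> X" for q
    unfolding T_def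
  proof (rule log_step_limit_fixed[where U = "\<lambda>k. (T ^^ k) v"])
    \<comment> \<open>Applying \<open>T\<close> shifts the sequence of iterates by one index, which
      keeps its limit.\<close>
    show "(\<lambda>k. log_step gs \<beta> W ((T ^^ k) v) q) \<longlonglongrightarrow> v q" if "q \<in> X" for q
      using LIMSEQ_Suc[OF lim_T[of v q]] that by (simp add: T_def)
  qed (use gmaps lim_T[of v] that in auto)
  have TSv: "T ((S ^^ k) v) q = (S ^^ k) v q" if "q \<in> X" for k q
    using that
  proof (induction k arbitrary: q)
    case (Suc k)
    have "T (S ((S ^^ k) v)) q = S (T ((S ^^ k) v)) q"
      using Suc.prems by (simp add: commute)
    also have "\<dots> = S ((S ^^ k) v) q"
      using Suc by (intro S_cong) auto
    finally show ?case by simp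
  qed (simp add: Tv)
  have Tu: "T u q = u q" if "q \<in> X" for q
    unfolding T_def
  proof (rule log_step_limit_fixed[where U = "\<lambda>k. (S ^^ k) v"])
    \<comment> \<open>On \<open>X\<close>, \<open>T\<close> leaves every term
      \<open>(S ^^ k) v\<close> unchanged, so the limit is that of \<open>lim_S\<close>.\<close>
    show "(\<lambda>k. log_step gs \<beta> W ((S ^^ k) v) q) \<longlonglongrightarrow> u q" if "q \<in> X" for q
      using lim_S[OF that] TSv[OF that] by (simp add: T_def)
  qed (use gmaps lim_S that in auto)
  have "(T ^^ k) u q = u q" if "q \<in> X" for k q
    using that
  proof (induction k arbitrary: q)
    case (Suc k)
    have "T ((T ^^ k) u) q = T u q"
      using Suc by (intro T_cong) auto
    then show ?case using Tu Suc.prems by simp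
  qed simp
  with lim_T[of u p] p show ?thesis
    by (simp add: LIMSEQ_const_iff)
qed

section \<open>Metric steps evaluated on vectors of ones\<close>

lemma vec_monomial_ones: "vec_monomial (replicate l 1) ks = 1"
  unfolding vec_monomial_def
proof (induction l arbitrary: ks)
  case (Suc l)
  then show ?case by (cases ks) auto
qed simp

lemma tensor_metrics_ones:
  "tensor_metrics l ms p (replicate (length ms * l) 1) = (\<Prod>m\<leftarrow>ms. m p (replicate l 1))"
  by (induction ms) (auto simp: take_replicate drop_replicate)

lemma prod_list_pos_ln:
  fixes F :: "'a \<Rightarrow> real"
  assumes "\<And>x. x \<in> set xs \<Longrightarrow> F x > 0"
  shows "(\<Prod>x\<leftarrow>xs. F x) > 0 \<and> ln (\<Prod>x\<leftarrow>xs. F x) = (\<Sum>x\<leftarrow>xs. ln (F x))"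
  using assms by (induction xs) (auto simp: ln_mult_pos)

lemma absolute_value_on_pos:
  assumes "absolute_value_on UNIV w" "x \<noteq> 0"
  shows "w x > 0"
  using assms unfolding absolute_value_on_def by (metis UNIV_I order_le_less)

text \<open>Supplies the character at which the compatibility of the isomorphisms is
  evaluated.\<close>

lemma multiplicative_char_ln:
  assumes "absolute_value_on UNIV w"
  shows "multiplicative_char (\<lambda>x. ln (w x))"
proof -
  have "w (x * y) = w x * w y" for x y
    using assms by (simp add: absolute_value_on_def)
  then show ?thesis
    using absolute_value_on_pos[OF assms] by (simp add: multiplicative_char_def ln_mult_pos)
qed

text \<open>On ones every monomial is 1, so the isomorphism contributes the product of the
  \<open>w (h p) powr c\<close>, with logarithm \<open>riso_value\<close>. The tensor product splits
  into blocks of ones, one for each map, and the exponent \<open>1 / \<alpha>\<close> becomes the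
  division in \<open>log_step\<close>.\<close>

lemma metric_step_ones:
  assumes w: "absolute_value_on UNIV w"
    and h: "\<And>c ks ls h. (c, ks, ls, h) \<in> set \<phi> \<Longrightarrow> h p \<noteq> 0"
    and m: "\<And>f. f \<in> set fs \<Longrightarrow> m (f p) (replicate (length \<L>) 1) > 0"
  shows "metric_step w fs \<L> \<alpha> \<phi> m p (replicate (length \<L>) 1) > 0"
    and "log_norm (length \<L>) (metric_step w fs \<L> \<alpha> \<phi> m) p =
      log_step fs \<alpha> (riso_value (\<lambda>x. ln (w x)) \<phi>) (log_norm (length \<L>) m) p"
proof -
  define A where "A = (\<Prod>(c, ks, ls, h)\<leftarrow>\<phi>. w (h p) powr c)"
  define B where "B = (\<Prod>f\<leftarrow>fs. m (f p) (replicate (length \<L>) 1))"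
  have step: "metric_step w fs \<L> \<alpha> \<phi> m p (replicate (length \<L>) 1) = (A * B) powr (1 / \<alpha>)"
    using tensor_metrics_ones[of "length \<L>" "map (\<lambda>f. pullback_metric f m) fs" p]
    by (simp add: metric_step_def iso_pullback_metric_def vec_monomial_ones A_def B_def
        pullback_metric_def o_def)
  have hpos: "w (h p) > 0" if "(c, ks, ls, h) \<in> set \<phi>" for c ks ls h
    using absolute_value_on_pos[OF w] h that by blast
  have A: "A > 0 \<and> ln A = (\<Sum>x\<leftarrow>\<phi>. ln (case x of (c, ks, ls, h) \<Rightarrow> w (h p) powr c))"
    unfolding A_def by (rule prod_list_pos_ln) (use hpos in fastforce)
  have "(\<Sum>x\<leftarrow>\<phi>. ln (case x of (c, ks, ls, h) \<Rightarrow> w (h p) powr c)) =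
      riso_value (\<lambda>x. ln (w x)) \<phi> p"
    unfolding riso_value_def using hpos
    by (intro arg_cong[where f = sum_list] map_cong) (auto simp: ln_powr split: prod.splits)
  with A have A': "A > 0" "ln A = riso_value (\<lambda>x. ln (w x)) \<phi> p" by auto
  have B: "B > 0" "ln B = (\<Sum>f\<leftarrow>fs. log_norm (length \<L>) m (f p))"
    using prod_list_pos_ln[of fs "\<lambda>f. m (f p) (replicate (length \<L>) 1)"] m
    by (auto simp: B_def log_norm_def)
  show "metric_step w fs \<L> \<alpha> \<phi> m p (replicate (length \<L>) 1) > 0"
    using A' B by (simp add: step)
  show "log_norm (length \<L>) (metric_step w fs \<L> \<alpha> \<phi> m) p =
      log_step fs \<alpha> (riso_value (\<lambda>x. ln (w x)) \<phi>) (log_norm (length \<L>) m) p"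
    unfolding log_norm_def[of _ "metric_step w fs \<L> \<alpha> \<phi> m"] step
    using A' B by (simp add: ln_powr ln_mult_pos log_step_def)
qed

text \<open>Positivity is carried along in the induction, since taking the logarithm of the next
  step requires it at the points \<open>f p\<close>.\<close>

lemma metric_step_iterate_ones:
  assumes w: "absolute_value_on UNIV w"
    and h: "\<And>c ks ls h p. (c, ks, ls, h) \<in> set \<phi> \<Longrightarrow> p \<in> X \<Longrightarrow> h p \<noteq> 0"
    and maps: "\<And>f. f \<in> set fs \<Longrightarrow> f ` X \<subseteq> X"
    and m: "\<And>p. p \<in> X \<Longrightarrow> m p (replicate (length \<L>) 1) > 0"
    and p: "p \<in> X"
  shows "(metric_step w fs \<L> \<alpha> \<phi> ^^ k) m p (replicate (length \<L>) 1) > 0 \<and>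
    log_norm (length \<L>) ((metric_step w fs \<L> \<alpha> \<phi> ^^ k) m) p =
      (log_step fs \<alpha> (riso_value (\<lambda>x. ln (w x)) \<phi>) ^^ k) (log_norm (length \<L>) m) p"
  using p
proof (induction k arbitrary: p)
  case (Suc k)
  let ?m = "(metric_step w fs \<L> \<alpha> \<phi> ^^ k) m"
  have pos: "?m (f p) (replicate (length \<L>) 1) > 0" if "f \<in> set fs" for f
    using Suc.IH maps[OF that] Suc.prems by blast
  have "log_step fs \<alpha> (riso_value (\<lambda>x. ln (w x)) \<phi>) (log_norm (length \<L>) ?m) p =
      log_step fs \<alpha> (riso_value (\<lambda>x. ln (w x)) \<phi>)
        ((log_step fs \<alpha> (riso_value (\<lambda>x. ln (w x)) \<phi>) ^^ k) (log_norm (length \<L>) m)) p"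
    using Suc.IH maps Suc.prems by (intro log_step_cong) blast
  then show ?case
    using metric_step_ones[OF w, of \<phi> p fs ?m \<L> \<alpha>] h[OF _ Suc.prems] pos by simp
qed (simp add: m)

section \<open>Logarithmic limits of canonical metrics, and the return to all vectors\<close>

lemma ones_in_fibre: "replicate (length \<L>) 1 \<in> fibre \<L>"
  by (auto simp: fibre_def)

lemma admissible_metric_ones_pos:
  "admissible_metric K w n X \<L> m \<Longrightarrow> p \<in> X \<Longrightarrow> m p (replicate (length \<L>) 1) > 0"
  using ones_in_fibre unfolding admissible_metric_def metric_on_def by blast

text \<open>For positive norms, the logarithm of the ratio bounded in
  \<open>metric_converges\<close> is the difference of the two values of
  \<open>log_norm\<close>.\<close>

lemma canonical_metric_log_limit:
  assumes sys: "polarized_system K n X fs \<L> \<alpha> \<phi>"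
    and w: "absolute_value_on UNIV w"
    and can: "canonical_metric K w n X fs \<L> \<alpha> \<phi> m"
    and m1: "admissible_metric K w n X \<L> m1"
    and p: "p \<in> X"
  shows "(\<lambda>k. (log_step fs \<alpha> (riso_value (\<lambda>x. ln (w x)) \<phi>) ^^ k) (log_norm (length \<L>) m1) p)
    \<longlonglongrightarrow> log_norm (length \<L>) m p"
proof (rule LIMSEQ_I)
  fix \<epsilon> :: real
  assume "\<epsilon> > 0"
  let ?M = "\<lambda>k. (metric_step w fs \<L> \<alpha> \<phi> ^^ k) m1"
  let ?s = "replicate (length \<L>) 1"
  have "metric_converges X \<L> ?M m"
    using can m1 unfolding canonical_metric_def by blast
  with \<open>\<epsilon> > 0\<close> p ones_in_fibre[of \<L>]
  obtain N where N: "\<And>k. k \<ge> N \<Longrightarrow> \<bar>ln (?M k p ?s / m p ?s)\<bar> < \<epsilon>"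
    unfolding metric_converges_def by metis
  have h: "h q \<noteq> 0" if "(c, ks, ls, h) \<in> set \<phi>" "q \<in> X" for c ks ls h q
    using sys that unfolding polarized_system_def rl_iso_def lb_iso_def by fastforce
  have maps: "f ` X \<subseteq> X" if "f \<in> set fs" for f
    using sys that unfolding polarized_system_def morphism_def by blast
  have mpos: "m p ?s > 0"
    using can p admissible_metric_ones_pos unfolding canonical_metric_def by blast
  have it: "?M k p ?s > 0 \<and> log_norm (length \<L>) (?M k) p =
      (log_step fs \<alpha> (riso_value (\<lambda>x. ln (w x)) \<phi>) ^^ k) (log_norm (length \<L>) m1) p" for k
    using w h maps admissible_metric_ones_pos[OF m1] p by (rule metric_step_iterate_ones)
  have "\<bar>(log_step fs \<alpha> (riso_value (\<lambda>x. ln (w x)) \<phi>) ^^ k) (log_norm (length \<L>) m1) p -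
      log_norm (length \<L>) m p\<bar> < \<epsilon>" if "k \<ge> N" for k
    using N[OF that] it[of k] mpos by (simp add: log_norm_def ln_div)
  then show "\<exists>N. \<forall>k\<ge>N. norm ((log_step fs \<alpha> (riso_value (\<lambda>x. ln (w x)) \<phi>) ^^ k)
      (log_norm (length \<L>) m1) p - log_norm (length \<L>) m p) < \<epsilon>"
    by auto
qed

text \<open>Homogeneity leads from the vector of ones to any \<open>s\<close> by changing one entry
  at a time, with a factor that is the same for both metrics.\<close>

lemma metric_on_eqI:
  assumes m: "metric_on w X \<L> m" and m': "metric_on w X \<L> m'"
    and p: "p \<in> X" and s: "s \<in> fibre \<L>"
    and ones: "m p (replicate (length \<L>) 1) = m' p (replicate (length \<L>) 1)"
  shows "m p s = m' p s"
proof -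
  \<comment> \<open>Interpolates between the vector of ones at \<open>j = 0\<close> and
    \<open>s\<close> at \<open>j = length \<L>\<close>.\<close>
  let ?t = "\<lambda>j. take j s @ replicate (length \<L> - j) 1"
  have len: "length s = length \<L>" and nz: "0 \<notin> set s"
    using s by (auto simp: fibre_def)
  have "m p (?t j) = m' p (?t j)" if "j \<le> length \<L>" for j
    using that
  proof (induction j)
    case (Suc j)
    have sj: "s ! j \<noteq> 0"
      using nz Suc.prems len by (metis Suc_le_lessD nth_mem)
    have fib: "?t j \<in> fibre \<L>"
      using nz Suc.prems len by (auto simp: fibre_def dest: in_set_takeD)
    have t_nth: "?t j ! j = 1"
      using Suc.prems len by (simp add: nth_append)
    have "replicate (length \<L> - j) (1::'a) = 1 # replicate (length \<L> - Suc j) 1"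
      using Suc.prems by (metis Suc_diff_Suc Suc_le_lessD replicate_Suc)
    \<comment> \<open>The trivial factor \<open>?t j ! j = 1\<close> gives the update the form that
      \<open>metric_on\<close> speaks about.\<close>
    then have t_Suc: "?t (Suc j) = (?t j)[j := s ! j * ?t j ! j]"
      using Suc.prems len by (simp add: nth_append list_update_append take_Suc_conv_app_nth)
    have step: "M p (?t (Suc j)) = w (s ! j) powr fst (\<L> ! j) * M p (?t j)"
      if "metric_on w X \<L> M" for M
      using that p fib sj Suc.prems unfolding t_Suc metric_on_def by auto
    show ?case
      using step[OF m] step[OF m'] Suc by simp
  qed (simp add: ones)
  from this[of "length \<L>"] show ?thesis by (simp add: len[symmetric])
qed

theorem proposition5p3:
  fixes K :: "'c::{alg_closed_field,field_char_0} set"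
    and n :: nat
    and X :: "'c point set"
    and fs gs :: "('c point \<Rightarrow> 'c point) list"
    and \<L> :: "'c rlbundle"
    and \<alpha> \<beta> :: real
    and \<phi> \<psi> :: "'c riso"
  assumes "number_field K"
    and "projective_variety K n X"
    and "polarized_system K n X fs \<L> \<alpha> \<phi>"
    and "polarized_system K n X gs \<L> \<beta> \<psi>"
    and "\<forall>f\<in>set fs. \<forall>g\<in>set gs. \<forall>p\<in>X. f (g p) = g (f p)"
    and "compatible_isos X fs \<alpha> \<phi> gs \<beta> \<psi>"
  shows "\<forall>v w. place K v \<and> closure_of_completion K v w \<longrightarrow>
    (\<forall>m\<^sub>F m\<^sub>G. canonical_metric K w n X fs \<L> \<alpha> \<phi> m\<^sub>F \<and> canonical_metric K w n X gs \<L> \<beta> \<psi> m\<^sub>G \<longrightarrow>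
      (\<forall>p\<in>X. \<forall>s\<in>fibre \<L>. m\<^sub>F p s = m\<^sub>G p s))"
proof (intro allI impI ballI)
  fix v w m\<^sub>F m\<^sub>G p s
  assume "place K v \<and> closure_of_completion K v w"
    and can: "canonical_metric K w n X fs \<L> \<alpha> \<phi> m\<^sub>F \<and> canonical_metric K w n X gs \<L> \<beta> \<psi> m\<^sub>G"
    and p: "p \<in> X" and s: "s \<in> fibre \<L>"
  then have w: "absolute_value_on UNIV w"
    by (simp add: closure_of_completion_def)
  let ?V = "riso_value (\<lambda>x. ln (w x)) \<phi>" and ?W = "riso_value (\<lambda>x. ln (w x)) \<psi>"
  let ?u = "log_norm (length \<L>) m\<^sub>F" and ?v = "log_norm (length \<L>) m\<^sub>G"
  have adm: "admissible_metric K w n X \<L> m\<^sub>F" "admissible_metric K w n X \<L> m\<^sub>G"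
    using can by (auto simp: canonical_metric_def)
  have "\<alpha> \<noteq> 0" "\<beta> \<noteq> 0"
    using assms(3,4) by (auto simp: polarized_system_def)
  \<comment> \<open>\<open>compatible_isos\<close> at the character \<open>ln (w x)\<close> is
    exactly the identity that \<open>log_step_commute\<close> requires.\<close>
  then have commute: "log_step fs \<alpha> ?V (log_step gs \<beta> ?W u) q =
      log_step gs \<beta> ?W (log_step fs \<alpha> ?V u) q" if "q \<in> X" for u q
    using assms(5,6) that multiplicative_char_ln[OF w]
    by (intro log_step_commute) (auto simp: compatible_isos_def)
  have "?u p = ?v p"
  proof (rule commuting_log_steps_same_limit[OF _ _ commute _ _ p])
    show "f ` X \<subseteq> X" if "f \<in> set fs" for f
      using assms(3) that unfolding polarized_system_def morphism_def by blast
    show "g ` X \<subseteq> X" if "g \<in> set gs" for g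
      using assms(4) that unfolding polarized_system_def morphism_def by blast
    \<comment> \<open>Canonical metrics are themselves admissible, so the iteration of either system
      may start at the canonical metric of the other.\<close>
    show "(\<lambda>k. (log_step fs \<alpha> ?V ^^ k) ?v q) \<longlonglongrightarrow> ?u q" if "q \<in> X" for q
      using canonical_metric_log_limit[OF assms(3) w] can adm that by blast
    show "(\<lambda>k. (log_step gs \<beta> ?W ^^ k) u q) \<longlonglongrightarrow> ?v q" if "u \<in> {?u, ?v}" "q \<in> X" for u q
      using canonical_metric_log_limit[OF assms(4) w] can adm that by blast
  qed
  \<comment> \<open>Positivity allows the logarithm to be cancelled.\<close>
  moreover have "m\<^sub>F p (replicate (length \<L>) 1) > 0" "m\<^sub>G p (replicate (length \<L>) 1) > 0"
    using adm p by (auto intro: admissible_metric_ones_pos)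
  ultimately have "m\<^sub>F p (replicate (length \<L>) 1) = m\<^sub>G p (replicate (length \<L>) 1)"
    by (simp add: log_norm_def)
  moreover have "metric_on w X \<L> m\<^sub>F" "metric_on w X \<L> m\<^sub>G"
    using adm by (auto simp: admissible_metric_def)
  ultimately show "m\<^sub>F p s = m\<^sub>G p s"
    using p s by (blast intro: metric_on_eqI)
qed

end
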